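(* Let $H$ be a real Hilbert space, let $F:H\to H$ be continuous and monotone, and let $f_\delta\in H$. For $a>0$ let $V_{\delta,a}\in H$ be the unique solution of $$F(V_{\delta,a})+aV_{\delta,a}-f_\delta=0.$$ Then $\|V_{\delta,a}\|=O\left(\frac1a\right)$ as $a\to\infty$, and $$\lim_{a\to\infty}\|F(V_{\delta,a})-f_\delta\|=\|F(0)-f_\delta\|.$$
   Context: Monotone means $\langle F(u)-F(v),u-v\rangle\ge0$ for all $u,v\in H$. It is known that for monotone continuous $F$ the equation $F(V)+aV-f_\delta=0$ has a unique solution for every $a>0$ and every $f_\delta\in H$. Here $\delta$ and $f_\delta$ are fixed. *)

theory Defs
  imports "HOL-Analysis.Analysis" "HOL-Library.Landau_Symbols"
begin

definition monotone_operator :: "('h::real_inner \<Rightarrow> 'h) \<Rightarrow> bool" where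
  "monotone_operator F \<longleftrightarrow> (\<forall>u v. (F u - F v) \<bullet> (u - v) \<ge> 0)"

text \<open>A solution of the regularized equation is unique, so a family of solutions \<open>V a\<close>, \<open>a > 0\<close>,
  is determined by the equation.\<close>

lemma regularized_solution_unique:
  fixes F :: "'h::real_inner \<Rightarrow> 'h"
  assumes mono: "monotone_operator F" and a: "a > 0"
    and u: "F u + a *\<^sub>R u - f = 0" and v: "F v + a *\<^sub>R v - f = 0"
  shows "u = v"
proof -
  have "F u - F v = - (a *\<^sub>R (u - v))"
    using u v by (simp add: algebra_simps)
  then have "- (a * ((u - v) \<bullet> (u - v))) \<ge> 0"
    using mono by (metis monotone_operator_def inner_minus_left inner_scaleR_left)
  then have "(u - v) \<bullet> (u - v) \<le> 0"
    using a by (simp add: mult_le_0_iff)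
  then show ?thesis
    by (metis inner_ge_zero inner_eq_zero_iff order_antisym eq_iff_diff_eq_0)
qed

end

theory Submission
  imports Defs
begin

text \<open>Monotonicity tested on the pair \<open>V a\<close>, 0, with the equation substituted for
  \<open>F (V a)\<close>, makes the term a |V a|^2 at most the inner product of f - F 0 with V a.
  Cauchy-Schwarz then gives |V a| \<le> |F 0 - f| / a, which is
  \<open>norm_regularized_solution_le\<close>. This bound is already the O(1/a) estimate; it also
  forces V a to 0 in norm, and continuity of F at 0 carries this limit over to the residual.\<close>

lemma norm_regularized_solution_le:
  fixes F :: "'h::real_inner \<Rightarrow> 'h"
  assumes mono: "monotone_operator F" and a: "a > 0"
    and v: "F v + a *\<^sub>R v - f = 0"
  shows "norm v \<le> norm (F 0 - f) / a"
proof -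
  have Fv: "F v = f - a *\<^sub>R v"
    using v by (simp add: algebra_simps)
  have "0 \<le> (F v - F 0) \<bullet> (v - 0)"
    using mono unfolding monotone_operator_def by blast
  also have "\<dots> = (f - F 0) \<bullet> v - a * (norm v)\<^sup>2"
    by (simp add: Fv inner_diff_left power2_norm_eq_inner)
  finally have "a * (norm v)\<^sup>2 \<le> (f - F 0) \<bullet> v"
    by simp
  also have "\<dots> \<le> norm (F 0 - f) * norm v"
    using norm_cauchy_schwarz[of "f - F 0" v] by (simp add: norm_minus_commute)
  finally have "(a * norm v) * norm v \<le> norm (F 0 - f) * norm v"
    by (simp add: power2_eq_square mult.assoc)
  \<comment> \<open>The factor \<open>norm v\<close> can be cancelled only if \<open>v\<close> is
    nonzero; for \<open>v = 0\<close> the claim is that a norm is nonnegative.\<close>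
  then have "a * norm v \<le> norm (F 0 - f)"
    by (cases "v = 0") (simp_all add: mult_le_cancel_right)
  then show ?thesis
    using a by (simp add: pos_le_divide_eq mult.commute)
qed

theorem lemma2p2:
  fixes F :: "'h::{real_inner, complete_space} \<Rightarrow> 'h"
    and f\<^sub>\<delta> :: 'h
    and V :: "real \<Rightarrow> 'h"
  assumes "continuous_on UNIV F"
    and "monotone_operator F"
    and "\<And>a. a > 0 \<Longrightarrow> F (V a) + a *\<^sub>R V a - f\<^sub>\<delta> = 0"
  shows "(\<lambda>a. norm (V a)) \<in> O[at_top](\<lambda>a. 1 / a)
    \<and> ((\<lambda>a. norm (F (V a) - f\<^sub>\<delta>)) \<longlongrightarrow> norm (F 0 - f\<^sub>\<delta>)) at_top"
proof
  define C where "C = norm (F 0 - f\<^sub>\<delta>)"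
  \<comment> \<open>The equation is given only for positive \<open>a\<close>, so the bound is stated
    for all sufficiently large \<open>a\<close>.\<close>
  have bound: "\<forall>\<^sub>F a in at_top. norm (V a) \<le> C / a"
    using eventually_gt_at_top[of 0]
    by eventually_elim (simp add: C_def norm_regularized_solution_le assms)
  show "(\<lambda>a. norm (V a)) \<in> O[at_top](\<lambda>a. 1 / a)"
  \<comment> \<open>\<open>C\<close> may be 0, namely when \<open>F 0\<close> equals the data; then
    \<open>V a = 0\<close> for all \<open>a > 0\<close>, and the estimate still holds.\<close>
  proof (rule bigoI[of _ C])
    show "\<forall>\<^sub>F a in at_top. norm (norm (V a)) \<le> C * norm (1 / a)"
      using bound eventually_gt_at_top[of 0] by eventually_elim simp
  qed
  have "((\<lambda>a. C / a) \<longlongrightarrow> 0) at_top"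
    by (intro tendsto_divide_0[OF tendsto_const] filterlim_at_top_imp_at_infinity filterlim_ident)
  \<comment> \<open>The same bound now serves as a squeeze.\<close>
  then have "(V \<longlongrightarrow> 0) at_top"
    using bound by (rule Lim_null_comparison[rotated])
  moreover have "isCont F 0"
    using assms(1) by (simp add: continuous_on_eq_continuous_at)
  ultimately have "((\<lambda>a. F (V a)) \<longlongrightarrow> F 0) at_top"
    using isCont_tendsto_compose by blast
  then show "((\<lambda>a. norm (F (V a) - f\<^sub>\<delta>)) \<longlongrightarrow> norm (F 0 - f\<^sub>\<delta>)) at_top"
    by (intro tendsto_intros)
qed

end
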